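(* Let $p,q,r\in[1,\infty)$ be such that $$\frac{1}{r}=\frac{1}{p}+\frac{1}{q}-1.$$ For every $f,g\in\mathcal{S}(\mathbb{R}_+)$ we have $$\left(\int_0^\infty y^{-1}|f\star g(y)|^r\,dy\right)^{\frac{1}{r}} \leqslant \left(\int_0^\infty y^{-1}|f(y)|^p\,dy\right)^{\frac{1}{p}}\left(\int_0^\infty y^{-1}|g(y)|^q\,dy\right)^{\frac{1}{q}}.$$
   Context: $\mathbb{R}_+=(0,\infty)$, $\mathbb{N}_0=\{0,1,2,\ldots\}$. $\mathcal{S}(\mathbb{R}_+)$ is the real vector space of all $f\in C^\infty(\mathbb{R}_+)$ (real-valued) such that for all $\alpha\in\mathbb{Z}$ and $\beta\in\mathbb{N}_0$ one has $\sup_{x\in\mathbb{R}_+} |x^\alpha f^{(\beta)}(x)| < \infty$. The Mellin convolution of $f,g\in\mathcal{S}(\mathbb{R}_+)$ is $f\star g(x):=\int_0^\infty y^{-1}f(xy^{-1})g(y)\,dy$ for $x\in\mathbb{R}_+$. *)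

theory Defs
  imports "HOL-Analysis.Analysis"
begin

text \<open>
  Functions on \<open>\<real>\<^sub>+ = (0, \<infinity>)\<close> are represented by total functions on the reals, of which only
  the values on \<open>{0<..}\<close> matter. As \<open>{0<..}\<close> is open, the derivatives at its points do not depend
  on the values elsewhere.
\<close>

definition smooth_on_Rplus :: "(real \<Rightarrow> real) \<Rightarrow> bool" where
  "smooth_on_Rplus f \<longleftrightarrow> (\<forall>n. (deriv ^^ n) f differentiable_on {0<..})"

definition schwartz_Rplus :: "(real \<Rightarrow> real) set" where
  "schwartz_Rplus =
     {f. smooth_on_Rplus f \<and>
         (\<forall>(\<alpha>::int) (\<beta>::nat). bdd_above ((\<lambda>x. \<bar>x powi \<alpha> * (deriv ^^ \<beta>) f x\<bar>) ` {0<..}))}"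

definition mellin_conv :: "(real \<Rightarrow> real) \<Rightarrow> (real \<Rightarrow> real) \<Rightarrow> real \<Rightarrow> real"  (infixl \<open>\<star>\<close> 70) where
  "(f \<star> g) x = (LBINT y:{0<..}. inverse y * f (x * inverse y) * g y)"

end

theory Submission
  imports Defs "HOL-Probability.Sinc_Integral"
begin

text \<open>
  The measure \<open>dx / x\<close> on \<open>(0, \<infinity>)\<close> is invariant under the dilations \<open>x \<mapsto> x / c\<close> and the
  reflections \<open>x \<mapsto> c / x\<close>; it is the Haar measure of the multiplicative group. The Mellin
  convolution is the convolution of that group, and the theorem is Young's inequality for it.

  With \<open>a = 1 / r\<close>, \<open>b = 1 / p - 1 / r\<close> and \<open>c = 1 / q - 1 / r\<close>, the relation between the exponents
  says that \<open>a + b + c = 1\<close>, while \<open>a + b = 1 / p\<close> and \<open>a + c = 1 / q\<close>. Hence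
  \<open>|f(x/y) g(y)| = (|f(x/y)|^p |g(y)|^q)^a (|f(x/y)|^p)^b (|g(y)|^q)^c\<close>,
  and Hoelder's inequality with the three weights (\<open>weighted_Holder\<close>) bounds the convolution at \<open>x\<close>
  by \<open>H(x)^a A^b B^c\<close>, where \<open>A\<close> and \<open>B\<close> are the integrals of \<open>|f|^p\<close> and \<open>|g|^q\<close> and \<open>H(x)\<close> is the
  integral of \<open>|f(x/y)|^p |g(y)|^q\<close> over \<open>y\<close>; the reflection \<open>y \<mapsto> x / y\<close> turns the second factor into
  \<open>A^b\<close>. Raised to the power \<open>r\<close>, this bound is linear in \<open>H\<close>, and by Fubini's theorem and invariance
  under dilations \<open>H\<close> has the integral \<open>A B\<close>. So the \<open>r\<close>-th power of the convolution has an integral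
  of at most \<open>A^(b r + 1) B^(c r + 1)\<close>, whose \<open>r\<close>-th root is \<open>A^(1/p) B^(1/q)\<close>
  (\<open>Young_convolution_Haar_Rplus\<close>).

  The Schwartz condition enters through the finiteness of \<open>A\<close> and \<open>B\<close>, which comes from the decay
  of the functions at \<open>0\<close> and at \<open>\<infinity>\<close> (\<open>schwartz_Rplus_powr_integrable\<close>), and through measurability.
\<close>

section \<open>Hoelder's inequality with several exponents\<close>

text \<open>Convexity of \<open>exp\<close> at the points \<open>ln (x i)\<close>.\<close>

lemma weighted_arith_geom_mean:
  fixes a x :: "'i \<Rightarrow> real"
  assumes fin: "finite I" and a: "\<And>i. i \<in> I \<Longrightarrow> a i \<ge> 0" "sum a I = 1"
    and x: "\<And>i. i \<in> I \<Longrightarrow> x i \<ge> 0"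
  shows "(\<Prod>i\<in>I. x i powr a i) \<le> (\<Sum>i\<in>I. a i * x i)"
proof (cases "\<exists>i\<in>I. x i = 0")
  case True
  then have "(\<Prod>i\<in>I. x i powr a i) = 0"
    using fin by (auto simp: prod_zero_iff)
  then show ?thesis
    using a x by (simp add: sum_nonneg)
next
  case False
  with x have pos: "x i > 0" if "i \<in> I" for i
    using that by (metis less_eq_real_def)
  have "I \<noteq> {}" using a(2) by auto
  have "(\<Prod>i\<in>I. x i powr a i) = exp (\<Sum>i\<in>I. a i *\<^sub>R ln (x i))"
    using fin less_imp_neq[OF pos] by (auto simp: exp_sum powr_def intro!: prod.cong)
  also have "\<dots> \<le> (\<Sum>i\<in>I. a i * exp (ln (x i)))"
    using convex_on_sum[OF fin \<open>I \<noteq> {}\<close> exp_convex a(2) a(1), of "\<lambda>i. ln (x i)"] by simp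
  also have "\<dots> = (\<Sum>i\<in>I. a i * x i)"
    using pos by (auto intro!: sum.cong)
  finally show ?thesis .
qed

text \<open>
  After division by their integrals all factors have integral \<open>1\<close>, and the integrated inequality of
  arithmetic and geometric means has the right-hand side \<open>sum a I = 1\<close>. A factor whose integral
  vanishes is zero almost everywhere. In that case both sides vanish even if its weight is \<open>0\<close>,
  because \<open>0 powr 0 = 0\<close>.
\<close>

lemma weighted_Holder:
  fixes a :: "'i \<Rightarrow> real" and u :: "'i \<Rightarrow> 'a \<Rightarrow> real"
  assumes fin: "finite I" and a: "\<And>i. i \<in> I \<Longrightarrow> a i \<ge> 0" "sum a I = 1"
    and int: "\<And>i. i \<in> I \<Longrightarrow> integrable M (u i)"
    and nn: "\<And>i x. i \<in> I \<Longrightarrow> u i x \<ge> 0"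
  shows "(\<integral>x. (\<Prod>i\<in>I. u i x powr a i) \<partial>M) \<le> (\<Prod>i\<in>I. (\<integral>x. u i x \<partial>M) powr a i)"
proof (cases "\<exists>i\<in>I. (\<integral>x. u i x \<partial>M) = 0")
  case True
  then obtain i where i: "i \<in> I" "(\<integral>x. u i x \<partial>M) = 0" by auto
  then have "AE x in M. u i x = 0"
    using integral_nonneg_eq_0_iff_AE[OF int[OF i(1)]] nn[OF i(1)] by auto
  then have "AE x in M. (\<Prod>i\<in>I. u i x powr a i) = 0"
    by eventually_elim (use fin i in auto)
  then have "(\<integral>x. (\<Prod>i\<in>I. u i x powr a i) \<partial>M) = 0"
    by (rule integral_eq_zero_AE)
  then show ?thesis by (simp add: prod_nonneg)
next
  case False
  define U where "U i = (\<integral>x. u i x \<partial>M)" for i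
  have U: "U i > 0" if "i \<in> I" for i
    using False that nn[OF that] unfolding U_def
    by (metis integral_nonneg_AE AE_I2 less_eq_real_def)
  have "(\<integral>x. (\<Prod>i\<in>I. u i x powr a i) \<partial>M)
      \<le> (\<integral>x. (\<Prod>i\<in>I. U i powr a i) * (\<Sum>i\<in>I. a i * (u i x / U i)) \<partial>M)"
  proof (rule integral_mono')
    show "integrable M (\<lambda>x. (\<Prod>i\<in>I. U i powr a i) * (\<Sum>i\<in>I. a i * (u i x / U i)))"
      using int by auto
    fix x
    have "(\<Prod>i\<in>I. u i x powr a i) = (\<Prod>i\<in>I. U i powr a i) * (\<Prod>i\<in>I. (u i x / U i) powr a i)"
      unfolding prod.distrib[symmetric]
    proof (rule prod.cong[OF refl])
      fix i assume "i \<in> I"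
      then show "u i x powr a i = U i powr a i * (u i x / U i) powr a i"
        using U[of i] nn[of i x] by (simp flip: powr_mult)
    qed
    also have "\<dots> \<le> (\<Prod>i\<in>I. U i powr a i) * (\<Sum>i\<in>I. a i * (u i x / U i))"
      using U nn by (intro mult_left_mono weighted_arith_geom_mean fin a prod_nonneg divide_nonneg_pos) auto
    finally show "(\<Prod>i\<in>I. u i x powr a i) \<le> (\<Prod>i\<in>I. U i powr a i) * (\<Sum>i\<in>I. a i * (u i x / U i))" .
    show "0 \<le> (\<Prod>i\<in>I. U i powr a i) * (\<Sum>i\<in>I. a i * (u i x / U i))"
      using U nn a by (intro mult_nonneg_nonneg prod_nonneg sum_nonneg divide_nonneg_pos) auto
  qed
  also have "\<dots> = (\<Prod>i\<in>I. U i powr a i) * (\<Sum>i\<in>I. a i * (U i / U i))"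
  proof -
    have "(\<integral>x. (\<Sum>i\<in>I. a i * (u i x / U i)) \<partial>M) = (\<Sum>i\<in>I. (\<integral>x. a i * (u i x / U i) \<partial>M))"
      using int by (intro Bochner_Integration.integral_sum) auto
    then show ?thesis
      by (simp only: integral_mult_right_zero integral_divide_zero flip: U_def)
  qed
  also have "(\<Sum>i\<in>I. a i * (U i / U i)) = 1"
    using U a(2) by (subst sum.cong[OF refl, where h = a]) (auto simp: less_imp_neq[symmetric] dest: U)
  finally show ?thesis by (simp add: U_def)
qed

section \<open>The multiplicative Haar measure\<close>

text \<open>
  The measure lives on the whole line and gives no mass to \<open>(-\<infinity>, 0]\<close>, so that its measurable sets
  are the Borel sets of the reals.
\<close>

definition Haar_Rplus :: "real measure" where
  "Haar_Rplus = density lborel (\<lambda>x. ennreal (indicator {0<..} x * inverse x))"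

lemma sets_Haar_Rplus [measurable_cong, simp]: "sets Haar_Rplus = sets borel"
  by (simp add: Haar_Rplus_def)

lemma measurable_Haar_Rplus [simp]: "measurable Haar_Rplus N = measurable borel N"
  by (rule measurable_cong_sets) simp_all

interpretation Haar_Rplus: sigma_finite_measure Haar_Rplus
  unfolding Haar_Rplus_def
  by (subst sigma_finite_measure.sigma_finite_iff_density_finite[OF sigma_finite_lborel]) auto

lemma AE_Haar_Rplus_pos: "AE x in Haar_Rplus. x > 0"
  unfolding Haar_Rplus_def by (subst AE_density) (auto split: split_indicator)

lemma integrable_Haar_Rplus_iff:
  fixes h :: "real \<Rightarrow> real"
  assumes "h \<in> borel_measurable borel"
  shows "integrable Haar_Rplus h \<longleftrightarrow> set_integrable lborel {0<..} (\<lambda>x. inverse x * h x)"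
  unfolding Haar_Rplus_def set_integrable_def using assms
  by (subst integrable_density) (auto simp: mult.assoc split: split_indicator)

lemma integral_Haar_Rplus:
  fixes h :: "real \<Rightarrow> real"
  assumes "h \<in> borel_measurable borel"
  shows "integral\<^sup>L Haar_Rplus h = (LBINT x:{0<..}. inverse x * h x)"
  unfolding Haar_Rplus_def set_lebesgue_integral_def using assms
  by (subst integral_density) (auto simp: mult.assoc split: split_indicator)

text \<open>
  This form, over the completed Lebesgue measure, is the one in which the change of variables
  formula for injective maps is stated.
\<close>

lemma has_bochner_integral_Haar_Rplus_iff:
  fixes h :: "real \<Rightarrow> real"
  assumes "h \<in> borel_measurable borel"
  shows "has_bochner_integral Haar_Rplus h b \<longleftrightarrow>
    (\<lambda>x. inverse x * h x) absolutely_integrable_on {0<..}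
      \<and> integral {0<..} (\<lambda>x. inverse x * h x) = b"
proof -
  have m: "(\<lambda>x. indicator {0<..} x *\<^sub>R (inverse x * h x)) \<in> borel_measurable lborel"
    using assms by measurable
  have 1: "integrable Haar_Rplus h \<longleftrightarrow> (\<lambda>x. inverse x * h x) absolutely_integrable_on {0<..}"
    using integrable_completion[OF m] by (simp add: integrable_Haar_Rplus_iff[OF assms] set_integrable_def)
  have 2: "integral\<^sup>L Haar_Rplus h = integral {0<..} (\<lambda>x. inverse x * h x)"
    if "(\<lambda>x. inverse x * h x) absolutely_integrable_on {0<..}"
    using set_lebesgue_integral_eq_integral(2)[OF that] integral_completion[OF m]
    by (simp add: integral_Haar_Rplus[OF assms] set_lebesgue_integral_def)
  show ?thesis
    using 1 2 by (auto simp: has_bochner_integral_iff)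
qed

text \<open>
  The last hypothesis says that \<open>\<phi>\<close> preserves \<open>dx / x\<close> up to orientation; dilations and reflections
  satisfy it.
\<close>

lemma has_bochner_integral_Haar_Rplus_subst:
  fixes h \<phi> \<phi>' :: "real \<Rightarrow> real"
  assumes h [measurable]: "h \<in> borel_measurable borel"
    and \<phi> [measurable]: "\<phi> \<in> borel_measurable borel"
    and bij: "bij_betw \<phi> {0<..} {0<..}"
    and deriv: "\<And>y. y > 0 \<Longrightarrow> (\<phi> has_field_derivative \<phi>' y) (at y)"
    and inv: "\<And>y. y > 0 \<Longrightarrow> \<bar>\<phi>' y\<bar> / \<phi> y = 1 / y"
  shows "has_bochner_integral Haar_Rplus (\<lambda>y. h (\<phi> y)) b \<longleftrightarrow> has_bochner_integral Haar_Rplus h b"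
proof -
  have eq: "inverse y * h (\<phi> y) = \<bar>\<phi>' y\<bar> * (inverse (\<phi> y) * h (\<phi> y))" if "y \<in> {0<..}" for y
    using inv[of y] that by (simp add: divide_inverse)
  have "has_bochner_integral Haar_Rplus (\<lambda>y. h (\<phi> y)) b \<longleftrightarrow>
      (\<lambda>y. inverse y * h (\<phi> y)) absolutely_integrable_on {0<..}
        \<and> integral {0<..} (\<lambda>y. inverse y * h (\<phi> y)) = b"
    by (rule has_bochner_integral_Haar_Rplus_iff) measurable
  also have "\<dots> \<longleftrightarrow>
      (\<lambda>y. \<bar>\<phi>' y\<bar> * (inverse (\<phi> y) * h (\<phi> y))) absolutely_integrable_on {0<..}
        \<and> integral {0<..} (\<lambda>y. \<bar>\<phi>' y\<bar> * (inverse (\<phi> y) * h (\<phi> y))) = b"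
    by (intro arg_cong2[where f = "(\<and>)"] arg_cong2[where f = "(=)"] refl
          Henstock_Kurzweil_Integration.integral_cong set_integrable_cong eq)
  also have "\<dots> \<longleftrightarrow> (\<lambda>x. inverse x * h x) absolutely_integrable_on (\<phi> ` {0<..})
        \<and> integral (\<phi> ` {0<..}) (\<lambda>x. inverse x * h x) = b"
    using deriv bij
    by (intro has_absolute_integral_change_of_variables_1'[where f = "\<lambda>x. inverse x * h x"])
       (auto intro: has_field_derivative_at_within simp: bij_betw_def)
  also have "\<phi> ` {0<..} = {0<..}"
    using bij by (rule bij_betw_imp_surj_on)
  finally show ?thesis
    by (simp add: has_bochner_integral_Haar_Rplus_iff)
qed

lemma has_bochner_integral_Haar_Rplus_scale:
  fixes h :: "real \<Rightarrow> real"
  assumes h: "has_bochner_integral Haar_Rplus h b" and c: "c > 0"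
  shows "has_bochner_integral Haar_Rplus (\<lambda>x. h (x / c)) b"
proof (rule has_bochner_integral_Haar_Rplus_subst[where \<phi>' = "\<lambda>_. 1 / c", THEN iffD2, OF _ _ _ _ _ h])
  show "h \<in> borel_measurable borel"
    using h by (auto simp: has_bochner_integral_iff dest: borel_measurable_integrable)
  show "bij_betw (\<lambda>x. x / c) {0<..} {0<..}"
    using c by (intro bij_betwI[where g = "\<lambda>x. x * c"]) auto
qed (use c in \<open>auto intro!: derivative_eq_intros\<close>)

lemma has_bochner_integral_Haar_Rplus_reflect:
  fixes h :: "real \<Rightarrow> real"
  assumes h: "has_bochner_integral Haar_Rplus h b" and c: "c > 0"
  shows "has_bochner_integral Haar_Rplus (\<lambda>x. h (c / x)) b"
proof (rule has_bochner_integral_Haar_Rplus_subst[where \<phi>' = "\<lambda>x. - (c / x\<^sup>2)", THEN iffD2, OF _ _ _ _ _ h])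
  show "h \<in> borel_measurable borel"
    using h by (auto simp: has_bochner_integral_iff dest: borel_measurable_integrable)
  show "bij_betw (\<lambda>x. c / x) {0<..} {0<..}"
    using c by (intro bij_betwI[where g = "\<lambda>x. c / x"]) auto
qed (use c in \<open>auto intro!: derivative_eq_intros simp: power2_eq_square field_simps\<close>)

section \<open>Young's inequality on the multiplicative group\<close>

text \<open>
  The inner integral may diverge for some \<open>x\<close>, where it then has the default value \<open>0\<close>. By Fubini's
  theorem these \<open>x\<close> form a null set, and the outer integral does not see them.
\<close>

lemma Young_convolution_Haar_Rplus:
  fixes p q r :: real and F G :: "real \<Rightarrow> real"
  assumes pqr: "p \<ge> 1" "q \<ge> 1" "r \<ge> 1" and exps: "1 / r = 1 / p + 1 / q - 1"
    and [measurable]: "F \<in> borel_measurable borel" "G \<in> borel_measurable borel"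
    and F: "integrable Haar_Rplus (\<lambda>x. \<bar>F x\<bar> powr p)"
    and G: "integrable Haar_Rplus (\<lambda>x. \<bar>G x\<bar> powr q)"
  shows "(\<integral>x. \<bar>\<integral>y. F (x / y) * G y \<partial>Haar_Rplus\<bar> powr r \<partial>Haar_Rplus) powr (1 / r)
       \<le> (\<integral>x. \<bar>F x\<bar> powr p \<partial>Haar_Rplus) powr (1 / p)
         * (\<integral>x. \<bar>G x\<bar> powr q \<partial>Haar_Rplus) powr (1 / q)"
proof -
  let ?M = Haar_Rplus
  interpret pair_sigma_finite ?M ?M ..
  define A where "A = (\<integral>x. \<bar>F x\<bar> powr p \<partial>?M)"
  define B where "B = (\<integral>x. \<bar>G x\<bar> powr q \<partial>?M)"
  have A0: "A \<ge> 0" and B0: "B \<ge> 0" by (simp_all add: A_def B_def)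
  have hF: "has_bochner_integral ?M (\<lambda>x. \<bar>F x\<bar> powr p) A"
    using F by (simp add: has_bochner_integral_iff A_def)
  define a b c where "a = 1 / r" and "b = 1 / p - 1 / r" and "c = 1 / q - 1 / r"
  have abc: "a \<ge> 0" "b \<ge> 0" "c \<ge> 0" "a + b + c = 1"
  proof -
    have "1 / p \<le> 1" "1 / q \<le> 1" using pqr by simp_all
    moreover have "1 / r \<ge> 0" using pqr by simp
    ultimately show "a \<ge> 0" "b \<ge> 0" "c \<ge> 0" "a + b + c = 1"
      using exps unfolding a_def b_def c_def by linarith+
  qed
  have ab: "a + b = 1 / p" and ac: "a + c = 1 / q" and ar: "a * r = 1" "r > 0"
    using pqr by (simp_all add: a_def b_def c_def)

  define \<Phi> where "\<Phi> x y = \<bar>F (x / y)\<bar> powr p * \<bar>G y\<bar> powr q" for x y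
  have \<Phi>_nn: "\<Phi> x y \<ge> 0" for x y by (simp add: \<Phi>_def)
  define H where "H x = (\<integral>y. \<Phi> x y \<partial>?M)" for x
  \<comment> \<open>For fixed \<open>y\<close> the integral over \<open>x\<close> is known by invariance under dilations, so Fubini's theorem
      applies to \<open>\<Phi>\<close> in this order; the order is then exchanged to reach \<open>H\<close>.\<close>
  have \<Phi>_slice: "has_bochner_integral ?M (\<lambda>x. \<Phi> x y) (A * \<bar>G y\<bar> powr q)" if "y > 0" for y
    unfolding \<Phi>_def
    by (intro has_bochner_integral_mult_left has_bochner_integral_Haar_Rplus_scale[OF hF that])
  have \<Phi>_slice_AE: "AE y in ?M. has_bochner_integral ?M (\<lambda>x. \<Phi> x y) (A * \<bar>G y\<bar> powr q)"
    using AE_Haar_Rplus_pos by eventually_elim (rule \<Phi>_slice)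
  have \<Phi>_slice_eq: "AE y in ?M. (\<integral>x. \<Phi> x y \<partial>?M) = A * \<bar>G y\<bar> powr q"
    using \<Phi>_slice_AE by eventually_elim (rule has_bochner_integral_integral_eq)
  have [measurable]: "(\<lambda>(y, x). \<Phi> x y) \<in> borel_measurable (?M \<Otimes>\<^sub>M ?M)"
    unfolding \<Phi>_def by measurable
  have swapped: "integrable (?M \<Otimes>\<^sub>M ?M) (\<lambda>(y, x). \<Phi> x y)"
  proof (rule Fubini_integrable)
    show "AE y in ?M. integrable ?M (\<lambda>x. case (y, x) of (y, x) \<Rightarrow> \<Phi> x y)"
      using \<Phi>_slice_AE by eventually_elim (simp add: has_bochner_integral_iff)
    have "integrable ?M (\<lambda>y. \<integral>x. \<Phi> x y \<partial>?M) \<longleftrightarrow> integrable ?M (\<lambda>y. A * \<bar>G y\<bar> powr q)"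
      by (rule integrable_cong_AE[OF _ _ \<Phi>_slice_eq]) measurable
    then show "integrable ?M (\<lambda>y. \<integral>x. norm (case (y, x) of (y, x) \<Rightarrow> \<Phi> x y) \<partial>?M)"
      using G by (simp add: \<Phi>_nn)
  qed measurable
  have \<Phi>_int: "integrable (?M \<Otimes>\<^sub>M ?M) (\<lambda>(x, y). \<Phi> x y)"
    using integrable_product_swap[OF swapped] by simp
  have H_int: "integrable ?M H"
    using integrable_fst'[OF \<Phi>_int] by (simp add: H_def[abs_def])
  have "integral\<^sup>L ?M H = (\<integral>y. (\<integral>x. \<Phi> x y \<partial>?M) \<partial>?M)"
    using Fubini_integral[OF \<Phi>_int] by (simp add: H_def[abs_def])
  also have "\<dots> = (\<integral>y. A * \<bar>G y\<bar> powr q \<partial>?M)"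
    by (rule integral_cong_AE[OF _ _ \<Phi>_slice_eq]) measurable
  finally have H_eq: "integral\<^sup>L ?M H = A * B" by (simp add: B_def)
  have H_nn: "H x \<ge> 0" for x by (simp add: H_def \<Phi>_nn)

  define K where "K = A powr (b * r) * B powr (c * r)"
  have K_nn: "K \<ge> 0" by (simp add: K_def)
  have bound: "\<bar>\<integral>y. F (x / y) * G y \<partial>?M\<bar> powr r \<le> K * H x"
    if x: "x > 0" "integrable ?M (\<lambda>y. \<Phi> x y)" for x
  proof -
    \<comment> \<open>The factors, listed to match the weights \<open>[a, b, c]\<close>.\<close>
    define u where "u i y = [\<Phi> x y, \<bar>F (x / y)\<bar> powr p, \<bar>G y\<bar> powr q] ! i" for i y
    have three: "{..<3} = {0, 1, 2::nat}" by auto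
    have u_prod: "\<bar>F (x / y) * G y\<bar> = (\<Prod>i<3. u i y powr ([a, b, c] ! i))" for y
    proof -
      have "\<bar>F (x / y)\<bar> powr (p * (a + b)) = \<bar>F (x / y)\<bar>" "\<bar>G y\<bar> powr (q * (a + c)) = \<bar>G y\<bar>"
        using pqr by (simp_all add: ab ac)
      then show ?thesis
        by (simp add: three u_def \<Phi>_def abs_mult powr_mult powr_powr distrib_left powr_add mult_ac)
    qed
    have reflected: "has_bochner_integral ?M (\<lambda>y. \<bar>F (x / y)\<bar> powr p) A"
      by (rule has_bochner_integral_Haar_Rplus_reflect[OF hF x(1)])
    have "\<bar>\<integral>y. F (x / y) * G y \<partial>?M\<bar> \<le> (\<integral>y. \<bar>F (x / y) * G y\<bar> \<partial>?M)"
      by (rule integral_abs_bound)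
    also have "\<dots> \<le> (\<Prod>i<3. (\<integral>y. u i y \<partial>?M) powr ([a, b, c] ! i))"
      unfolding u_prod
    proof (rule weighted_Holder)
      show "integrable ?M (u i)" if "i \<in> {..<3}" for i
        using that x(2) reflected G unfolding three by (auto simp: u_def[abs_def] has_bochner_integral_iff)
    qed (use abc \<Phi>_nn in \<open>auto simp: three u_def\<close>)
    also have "\<dots> = H x powr a * A powr b * B powr c"
      using reflected by (simp add: three u_def H_def B_def has_bochner_integral_iff)
    finally have "\<bar>\<integral>y. F (x / y) * G y \<partial>?M\<bar> powr r \<le> (H x powr a * A powr b * B powr c) powr r"
      using ar by (intro powr_mono2) auto
    also have "\<dots> = K * H x"
      using H_nn[of x] by (simp add: K_def powr_mult powr_powr ar mult_ac)
    finally show ?thesis .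
  qed
  have "(\<integral>x. \<bar>\<integral>y. F (x / y) * G y \<partial>?M\<bar> powr r \<partial>?M) \<le> (\<integral>x. K * H x \<partial>?M)"
  proof (rule integral_mono_AE)
    show "AE x in ?M. \<bar>\<integral>y. F (x / y) * G y \<partial>?M\<bar> powr r \<le> K * H x"
      using AE_integrable_fst'[OF \<Phi>_int] AE_Haar_Rplus_pos by eventually_elim (simp add: bound)
    then show "integrable ?M (\<lambda>x. \<bar>\<integral>y. F (x / y) * G y \<partial>?M\<bar> powr r)"
      by (intro Bochner_Integration.integrable_bound[OF integrable_mult_right[OF H_int, of K]])
         (measurable, auto simp: K_nn H_nn)
  qed (use H_int in simp)
  also have "\<dots> = K * (A * B)" by (simp add: H_eq)
  finally have "(\<integral>x. \<bar>\<integral>y. F (x / y) * G y \<partial>?M\<bar> powr r \<partial>?M) powr (1 / r) \<le> (K * (A * B)) powr a"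
    unfolding a_def using pqr by (intro powr_mono2) auto
  also have "\<dots> = A powr (a + b) * B powr (a + c)"
  proof -
    have "b * r * a = b" "c * r * a = c"
      using ar(1) by (simp_all add: mult.assoc mult.commute[of r])
    then have "(K * (A * B)) powr a = A powr b * B powr c * (A powr a * B powr a)"
      using A0 B0 by (simp only: K_def powr_mult powr_powr powr_ge_zero mult_nonneg_nonneg)
    then show ?thesis
      by (simp add: powr_add mult_ac)
  qed
  finally show ?thesis by (simp add: ab ac A_def B_def)
qed

section \<open>Schwartz functions on the half-line\<close>

lemma schwartz_Rplus_measurable:
  assumes "f \<in> schwartz_Rplus"
  shows "(\<lambda>x. indicator {0<..} x * f x) \<in> borel_measurable borel"
proof -
  have "(deriv ^^ 0) f differentiable_on {0<..}"
    using assms unfolding schwartz_Rplus_def smooth_on_Rplus_def by blast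
  then have "continuous_on {0<..} f"
    by (simp add: differentiable_imp_continuous_on)
  then show ?thesis
    using borel_measurable_continuous_on_indicator[of "{0<..}" f] by simp
qed

lemma schwartz_Rplus_bound:
  assumes "f \<in> schwartz_Rplus"
  obtains C where "\<And>x. x > 0 \<Longrightarrow> \<bar>x powi \<alpha> * f x\<bar> \<le> C"
proof -
  have "\<forall>(\<alpha>::int) (\<beta>::nat). bdd_above ((\<lambda>x. \<bar>x powi \<alpha> * (deriv ^^ \<beta>) f x\<bar>) ` {0<..})"
    using assms unfolding schwartz_Rplus_def by simp
  from this[rule_format, of \<alpha> 0] have "bdd_above ((\<lambda>x. \<bar>x powi \<alpha> * f x\<bar>) ` {0<..})"
    by simp
  then show ?thesis
    using that by (auto simp: bdd_above_def)
qed

text \<open>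
  As \<open>f\<close> is bounded and \<open>p \<ge> 1\<close>, the power \<open>|f|^p\<close> is at most a constant times \<open>|f|\<close>. The bounds on
  \<open>x |f x|\<close> and \<open>|f x| / x\<close> together bound \<open>(1 + x^2) |f x| / x\<close>, so \<open>1 / (1 + x^2)\<close> is an integrable
  majorant up to a constant.
\<close>

lemma schwartz_Rplus_powr_integrable:
  assumes f: "f \<in> schwartz_Rplus" and p: "p \<ge> 1"
  shows "integrable Haar_Rplus (\<lambda>x. \<bar>indicator {0<..} x * f x\<bar> powr p)"
proof -
  obtain C where C: "\<And>x. x > 0 \<Longrightarrow> \<bar>x powi 0 * f x\<bar> \<le> C"
    using schwartz_Rplus_bound[OF f] by metis
  obtain D where D: "\<And>x. x > 0 \<Longrightarrow> \<bar>x powi 1 * f x\<bar> \<le> D"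
    using schwartz_Rplus_bound[OF f] by metis
  obtain E where E: "\<And>x. x > 0 \<Longrightarrow> \<bar>x powi (-1) * f x\<bar> \<le> E"
    using schwartz_Rplus_bound[OF f] by metis
  note [measurable] = schwartz_Rplus_measurable[OF f]
  have "D \<ge> 0" "E \<ge> 0"
    using D[of 1] E[of 1] by simp_all
  have "integrable lborel (\<lambda>x::real. inverse (1 + x\<^sup>2))"
    using integrable_inverse_1_plus_square by (simp add: set_integrable_def)
  then have dom: "integrable lborel (\<lambda>x. C powr (p - 1) * (D + E) * inverse (1 + x\<^sup>2))"
    by (rule integrable_mult_right)
  have bound: "inverse x * \<bar>f x\<bar> powr p \<le> C powr (p - 1) * (D + E) * inverse (1 + x\<^sup>2)"
    if x: "x > 0" for x
  proof -
    have "\<bar>f x\<bar> powr p = \<bar>f x\<bar> powr (p - 1) * \<bar>f x\<bar>"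
      by (cases "f x = 0") (simp_all add: powr_diff)
    also have "\<dots> \<le> C powr (p - 1) * \<bar>f x\<bar>"
      using C[OF x] p by (intro mult_right_mono powr_mono2) auto
    finally have 1: "\<bar>f x\<bar> powr p \<le> C powr (p - 1) * \<bar>f x\<bar>" .
    have "inverse x * \<bar>f x\<bar> * (1 + x\<^sup>2) = inverse x * \<bar>f x\<bar> + x * \<bar>f x\<bar>"
      using x by (simp add: field_simps power2_eq_square)
    also have "\<dots> \<le> D + E"
      using D[OF x] E[OF x] x by (simp add: abs_mult power_int_minus)
    finally have 2: "inverse x * \<bar>f x\<bar> \<le> (D + E) * inverse (1 + x\<^sup>2)"
      by (simp add: field_simps add_pos_nonneg)
    have "inverse x * \<bar>f x\<bar> powr p \<le> C powr (p - 1) * (inverse x * \<bar>f x\<bar>)"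
      using mult_left_mono[OF 1, of "inverse x"] x by (simp add: mult_ac)
    also have "\<dots> \<le> C powr (p - 1) * ((D + E) * inverse (1 + x\<^sup>2))"
      using 2 by (intro mult_left_mono) auto
    finally show ?thesis by (simp add: mult_ac)
  qed
  have "set_integrable lborel {0<..} (\<lambda>x. inverse x * \<bar>indicator {0<..} x * f x\<bar> powr p)"
    unfolding set_integrable_def
  proof (rule Bochner_Integration.integrable_bound[OF dom])
    show "AE x in lborel. norm (indicator {0<..} x *\<^sub>R (inverse x * \<bar>indicator {0<..} x * f x\<bar> powr p))
        \<le> norm (C powr (p - 1) * (D + E) * inverse (1 + x\<^sup>2))"
      using bound \<open>D \<ge> 0\<close> \<open>E \<ge> 0\<close> by (intro AE_I2) (auto split: split_indicator simp: abs_mult)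
  qed measurable
  then show ?thesis
    by (subst integrable_Haar_Rplus_iff) auto
qed

text \<open>
  Elements of \<open>schwartz_Rplus\<close> have arbitrary, possibly non-measurable, values at non-positive
  arguments. The indicators in the next two lemmas remove these values without changing the integrals.
\<close>

lemma LBINT_powr_eq_Haar_Rplus:
  fixes h :: "real \<Rightarrow> real"
  assumes [measurable]: "(\<lambda>x. indicator {0<..} x * h x) \<in> borel_measurable borel"
  shows "(LBINT y:{0<..}. inverse y * \<bar>h y\<bar> powr s)
    = (\<integral>y. \<bar>indicator {0<..} y * h y\<bar> powr s \<partial>Haar_Rplus)"
  by (subst integral_Haar_Rplus) (auto intro!: set_lebesgue_integral_cong)

lemma mellin_conv_eq_Haar_Rplus:
  assumes f [measurable]: "(\<lambda>x. indicator {0<..} x * f x) \<in> borel_measurable borel"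
    and g [measurable]: "(\<lambda>x. indicator {0<..} x * g x) \<in> borel_measurable borel"
  assumes x: "x > 0"
  shows "(f \<star> g) x
    = (\<integral>y. (indicator {0<..} (x / y) * f (x / y)) * (indicator {0<..} y * g y) \<partial>Haar_Rplus)"
proof -
  have [measurable]: "(\<lambda>y. indicator {0<..} (x / y) * f (x / y)) \<in> borel_measurable borel"
    by (rule measurable_compose[OF _ f]) measurable
  show ?thesis
    unfolding mellin_conv_def using x
    by (subst integral_Haar_Rplus)
       (auto intro!: set_lebesgue_integral_cong simp: divide_inverse)
qed

theorem theorem11:
  fixes p q r :: real and f g :: "real \<Rightarrow> real"
  assumes "p \<ge> 1" and "q \<ge> 1" and "r \<ge> 1"
    and "1 / r = 1 / p + 1 / q - 1"
    and "f \<in> schwartz_Rplus" and "g \<in> schwartz_Rplus"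
  shows "(LBINT y:{0<..}. inverse y * \<bar>(f \<star> g) y\<bar> powr r) powr (1 / r)
       \<le> (LBINT y:{0<..}. inverse y * \<bar>f y\<bar> powr p) powr (1 / p)
         * (LBINT y:{0<..}. inverse y * \<bar>g y\<bar> powr q) powr (1 / q)"
proof -
  let ?F = "\<lambda>x. indicator {0<..} x * f x" and ?G = "\<lambda>x. indicator {0<..} x * g x"
  note f = schwartz_Rplus_measurable[OF assms(5)] and g = schwartz_Rplus_measurable[OF assms(6)]
  note [measurable] = f g
  have [measurable]: "(\<lambda>(x, y). ?F (x / y)) \<in> borel_measurable (borel \<Otimes>\<^sub>M borel)"
    unfolding case_prod_beta by (rule measurable_compose[OF _ f]) measurable
  have meas: "(\<lambda>x. \<integral>y. ?F (x / y) * ?G y \<partial>Haar_Rplus) \<in> borel_measurable borel"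
    by measurable
  have "(LBINT x:{0<..}. inverse x * \<bar>(f \<star> g) x\<bar> powr r)
      = (LBINT x:{0<..}. inverse x * \<bar>\<integral>y. ?F (x / y) * ?G y \<partial>Haar_Rplus\<bar> powr r)"
    by (rule set_lebesgue_integral_cong) (auto simp: mellin_conv_eq_Haar_Rplus[OF f g])
  also have "\<dots> = (\<integral>x. \<bar>\<integral>y. ?F (x / y) * ?G y \<partial>Haar_Rplus\<bar> powr r \<partial>Haar_Rplus)"
    using meas by (subst integral_Haar_Rplus) auto
  finally show ?thesis
    using Young_convolution_Haar_Rplus[OF assms(1-4) f g
        schwartz_Rplus_powr_integrable[OF assms(5,1)] schwartz_Rplus_powr_integrable[OF assms(6,2)]]
    by (simp only: LBINT_powr_eq_Haar_Rplus[OF f] LBINT_powr_eq_Haar_Rplus[OF g])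
qed

end
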